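(* Let $Q$ be a semisymmetric quasigroup. If the nucleus $N(Q)$ of $Q$ is non-empty, then $Q$ is a loop, i.e. $Q$ has a two-sided identity element.
   Context: A semisymmetric quasigroup is a set $Q$ with a binary operation $\cdot$ satisfying $(x\cdot y)\cdot x = y$ for all $x,y\in Q$. (Such an operation is automatically a quasigroup operation.) A loop is a quasigroup with a two-sided identity element; a semisymmetric loop is also called a Mendelsohn loop. Juxtaposition denotes the operation with higher precedence. The nucleus is $N(Q)=N_\lambda(Q)\cap N_\mu(Q)\cap N_\rho(Q)$, where $N_\lambda(Q)=\{u\in Q: u\cdot xy = ux\cdot y \text{ for all } x,y\in Q\}$, $N_\mu(Q)=\{u\in Q: x\cdot uy = xu\cdot y \text{ for all } x,y\in Q\}$, $N_\rho(Q)=\{u\in Q: x\cdot yu = xy\cdot u \text{ for all } x,y\in Q\}$. *)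

theory Defs
  imports Main
begin

locale magma =
  fixes Q :: "'a set"
    and mult :: "'a \<Rightarrow> 'a \<Rightarrow> 'a"  (infixl "\<cdot>" 70)
  assumes closed: "\<lbrakk>x \<in> Q; y \<in> Q\<rbrakk> \<Longrightarrow> x \<cdot> y \<in> Q"
begin

definition left_nucleus :: "'a set" where
  "left_nucleus = {u \<in> Q. \<forall>x\<in>Q. \<forall>y\<in>Q. u \<cdot> (x \<cdot> y) = (u \<cdot> x) \<cdot> y}"

definition middle_nucleus :: "'a set" where
  "middle_nucleus = {u \<in> Q. \<forall>x\<in>Q. \<forall>y\<in>Q. x \<cdot> (u \<cdot> y) = (x \<cdot> u) \<cdot> y}"

definition right_nucleus :: "'a set" where
  "right_nucleus = {u \<in> Q. \<forall>x\<in>Q. \<forall>y\<in>Q. x \<cdot> (y \<cdot> u) = (x \<cdot> y) \<cdot> u}"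

definition nucleus :: "'a set" where
  "nucleus = left_nucleus \<inter> middle_nucleus \<inter> right_nucleus"

end

(* An empty quasigroup is allowed; a loop is non-empty because of its identity. *)

locale quasigroup = magma +
  assumes left_div: "\<lbrakk>a \<in> Q; b \<in> Q\<rbrakk> \<Longrightarrow> \<exists>!x. x \<in> Q \<and> a \<cdot> x = b"
    and right_div: "\<lbrakk>a \<in> Q; b \<in> Q\<rbrakk> \<Longrightarrow> \<exists>!y. y \<in> Q \<and> y \<cdot> a = b"

locale loop = quasigroup +
  assumes identity: "\<exists>e\<in>Q. \<forall>x\<in>Q. e \<cdot> x = x \<and> x \<cdot> e = x"

(* Unique divisibility is not assumed, since it follows from the semisymmetric law:
   a \<cdot> x = b iff x = b \<cdot> a, and y \<cdot> a = b iff y = a \<cdot> b. *)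

locale semisymmetric_quasigroup = magma +
  assumes semisymmetric: "\<lbrakk>x \<in> Q; y \<in> Q\<rbrakk> \<Longrightarrow> (x \<cdot> y) \<cdot> x = y"

end

theory Submission
  imports Defs
begin

text \<open>
  The semisymmetric law says that right multiplication by \<open>x\<close> undoes left multiplication by \<open>x\<close>.
  The law applied twice gives \<open>x \<cdot> (y \<cdot> x) = y\<close>, so the two translations are mutually inverse
  bijections, and \<open>Q\<close> is a quasigroup.

  In a quasigroup, an element \<open>u\<close> that associates in the middle transports its own local identities
  to all of \<open>Q\<close>: if \<open>f \<cdot> u = u\<close>, then \<open>f \<cdot> (u \<cdot> y) = (f \<cdot> u) \<cdot> y = u \<cdot> y\<close>, and
  every element has the form \<open>u \<cdot> y\<close>. So \<open>f\<close> is a left identity; dually, a solution \<open>e\<close> of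
  \<open>u \<cdot> e = u\<close> is a right identity, and the two must coincide.
\<close>

lemma (in quasigroup) middle_nucleus_imp_identity:
  assumes u: "u \<in> middle_nucleus"
  shows "\<exists>e\<in>Q. \<forall>x\<in>Q. e \<cdot> x = x \<and> x \<cdot> e = x"
proof -
  have uQ: "u \<in> Q"
    and assoc: "\<And>x y. x \<in> Q \<Longrightarrow> y \<in> Q \<Longrightarrow> x \<cdot> (u \<cdot> y) = (x \<cdot> u) \<cdot> y"
    using u by (auto simp: middle_nucleus_def)
  obtain f where f: "f \<in> Q" "f \<cdot> u = u" using right_div[OF uQ uQ] by blast
  obtain e where e: "e \<in> Q" "u \<cdot> e = u" using left_div[OF uQ uQ] by blast
  have left: "f \<cdot> z = z" if z: "z \<in> Q" for z
  proof -
    obtain y where "y \<in> Q" "u \<cdot> y = z" using left_div[OF uQ z] by blast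
    then show ?thesis using assoc[of f y] f by simp
  qed
  have right: "z \<cdot> e = z" if z: "z \<in> Q" for z
  proof -
    obtain x where "x \<in> Q" "x \<cdot> u = z" using right_div[OF uQ z] by blast
    then show ?thesis using assoc[of x e] e by simp
  qed
  have "f = e" using left[OF e(1)] right[OF f(1)] by simp
  then show ?thesis using left right e(1) by blast
qed

context semisymmetric_quasigroup
begin

text \<open>
  By the law, multiplying \<open>y \<cdot> x\<close> by \<open>y\<close> on the right gives \<open>x\<close>. A second use of the law, with
  \<open>y \<cdot> x\<close> as the outer factor, recovers \<open>y\<close>.
\<close>

lemma semisymmetric':
  assumes "x \<in> Q" "y \<in> Q"
  shows "x \<cdot> (y \<cdot> x) = y"
  using semisymmetric[of "y \<cdot> x" y] semisymmetric[of y x] closed[of y x] assms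
  by simp

lemma quasigroup: "quasigroup Q (\<cdot>)"
proof
  fix a b assume ab: "a \<in> Q" "b \<in> Q"
  show "\<exists>!x. x \<in> Q \<and> a \<cdot> x = b"
  proof (rule ex1I[of _ "b \<cdot> a"])
    show "b \<cdot> a \<in> Q \<and> a \<cdot> (b \<cdot> a) = b" using ab by (simp add: closed semisymmetric')
    show "x = b \<cdot> a" if "x \<in> Q \<and> a \<cdot> x = b" for x using that ab semisymmetric[of a x] by auto
  qed
  show "\<exists>!y. y \<in> Q \<and> y \<cdot> a = b"
  proof (rule ex1I[of _ "a \<cdot> b"])
    show "a \<cdot> b \<in> Q \<and> (a \<cdot> b) \<cdot> a = b" using ab by (simp add: closed semisymmetric)
    show "y = a \<cdot> b" if "y \<in> Q \<and> y \<cdot> a = b" for y using that ab semisymmetric'[of a y] by auto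
  qed
qed

end

theorem lemma3p1:
  fixes Q :: "'a set" and mult :: "'a \<Rightarrow> 'a \<Rightarrow> 'a"
  assumes "semisymmetric_quasigroup Q mult"
    and "magma.nucleus Q mult \<noteq> {}"
  shows "loop Q mult"
proof -
  interpret semisymmetric_quasigroup Q mult by fact
  interpret quasigroup Q mult by (rule quasigroup)
  obtain u where "u \<in> middle_nucleus" using assms(2) by (auto simp: nucleus_def)
  then show ?thesis by unfold_locales (rule middle_nucleus_imp_identity)
qed

end
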